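(* Every 2-separable convex function $f:\mathbb{Z}^n\to\mathbb{R}\cup\{+\infty\}$ is DDM-convex.
   Context: A function $g:\mathbb{Z}\to\mathbb{R}\cup\{+\infty\}$ is (univariate) discrete convex if $g(t-1)+g(t+1)\ge 2g(t)$ for all $t\in\mathbb{Z}$. A function $f:\mathbb{Z}^n\to\mathbb{R}\cup\{+\infty\}$ is 2-separable convex if it can be represented as $$f(x)=\sum_{i=1}^n \xi_i(x_i)+\sum_{i,j:\,j\ne i}\varphi_{ij}(x_i-x_j)+\sum_{i,j:\,j\ne i}\psi_{ij}(x_i+x_j)\qquad(x\in\mathbb{Z}^n)$$ for some univariate discrete convex functions $\xi_i,\varphi_{ij},\psi_{ij}:\mathbb{Z}\to\mathbb{R}\cup\{+\infty\}$ ($i=1,\dots,n$; $j\in\{1,\dots,n\}\setminus\{i\}$). For $x,y\in\mathbb{Z}^n$, the vector $\mu(x,y)\in\mathbb{Z}^n$ is defined componentwise by $\mu(x,y)_i=\lceil (x_i+y_i)/2\rceil$ if $x_i\ge y_i$, and $\mu(x,y)_i=\lfloor (x_i+y_i)/2\rfloor$ if $x_i<y_i$. A function $f:\mathbb{Z}^n\to\mathbb{R}\cup\{+\infty\}$ is called DDM-convex (directed discrete midpoint convex) if $f(x)+f(y)\ge f(\mu(x,y))+f(\mu(y,x))$ for all $x,y\in\mathbb{Z}^n$.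
   Formalization: Univariate discrete convex functions are additionally required to have an interval of integers as effective domain; without this the claim fails (n=1, f=0 on {0,3}, +∞ elsewhere, x=3, y=0). *)

theory Defs
  imports "HOL-Analysis.Analysis"
begin

text \<open>
  Functions into \<open>\<real> \<union> {+\<infinity>}\<close> are \<^typ>\<open>ereal\<close>-valued functions omitting the value \<open>-\<infinity>\<close>;
  \<open>\<int>\<^sup>n\<close> is \<open>int ^ 'n\<close> for a finite index type \<open>'n\<close>.
\<close>

text \<open>
  The second conjunct says that the effective domain is an interval of integers. For
  functions taking the value \<open>+\<infinity>\<close> it is part of discrete convexity but does not follow from the
  midpoint inequality: the function that is 0 on \<open>{0, 3}\<close> and \<open>+\<infinity>\<close> elsewhere satisfies the
  inequality at every \<open>t\<close>. Read as a function on \<open>\<int>\<^sup>1\<close>, it is not DDM-convex (take \<open>x = 3\<close>, \<open>y = 0\<close>).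
  For finite-valued functions the conjunct holds trivially.
\<close>

definition discrete_convex :: "(int \<Rightarrow> ereal) \<Rightarrow> bool" where
  "discrete_convex g \<longleftrightarrow>
     (\<forall>t. g t \<noteq> -\<infinity>) \<and>
     (\<forall>a b t. a \<le> t \<and> t \<le> b \<and> g a < \<infinity> \<and> g b < \<infinity> \<longrightarrow> g t < \<infinity>) \<and>
     (\<forall>t. g (t - 1) + g (t + 1) \<ge> 2 * g t)"

definition two_separable_convex :: "(int ^ 'n \<Rightarrow> ereal) \<Rightarrow> bool" where
  "two_separable_convex f \<longleftrightarrow>
     (\<forall>x. f x \<noteq> -\<infinity>) \<and>
     (\<exists>(\<xi> :: 'n \<Rightarrow> int \<Rightarrow> ereal) (\<phi> :: 'n \<Rightarrow> 'n \<Rightarrow> int \<Rightarrow> ereal) (\<psi> :: 'n \<Rightarrow> 'n \<Rightarrow> int \<Rightarrow> ereal).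
        (\<forall>i. discrete_convex (\<xi> i)) \<and>
        (\<forall>i j. j \<noteq> i \<longrightarrow> discrete_convex (\<phi> i j) \<and> discrete_convex (\<psi> i j)) \<and>
        (\<forall>x. f x = (\<Sum>i\<in>UNIV. \<xi> i (x $ i))
                 + (\<Sum>i\<in>UNIV. \<Sum>j\<in>UNIV - {i}. \<phi> i j (x $ i - x $ j))
                 + (\<Sum>i\<in>UNIV. \<Sum>j\<in>UNIV - {i}. \<psi> i j (x $ i + x $ j))))"

definition directed_midpoint :: "int ^ 'n \<Rightarrow> int ^ 'n \<Rightarrow> int ^ 'n" where
  "directed_midpoint x y =
     (\<chi> i. if x $ i \<ge> y $ i then \<lceil>real_of_int (x $ i + y $ i) / 2\<rceil>
           else \<lfloor>real_of_int (x $ i + y $ i) / 2\<rfloor>)"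

definition ddm_convex :: "(int ^ 'n \<Rightarrow> ereal) \<Rightarrow> bool" where
  "ddm_convex f \<longleftrightarrow>
     (\<forall>x. f x \<noteq> -\<infinity>) \<and>
     (\<forall>x y. f x + f y \<ge> f (directed_midpoint x y) + f (directed_midpoint y x))"

end

theory Submission
  imports Defs
begin

text \<open>
  Write \<open>p = \<mu>(x,y)\<close> and \<open>q = \<mu>(y,x)\<close>. Componentwise \<open>p + q = x + y\<close>, while \<open>p - q\<close> is the vector of
  remainders of \<open>x - y\<close> modulo 2, each carrying the sign of the corresponding component of \<open>x - y\<close>.
  So in every linear form \<open>\<ell>\<close> among \<open>x\<^sub>i\<close>, \<open>x\<^sub>i - x\<^sub>j\<close> and \<open>x\<^sub>i + x\<^sub>j\<close>, the pair \<open>\<ell>(p), \<ell>(q)\<close> has the same sum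
  as \<open>\<ell>(x), \<ell>(y)\<close> and lies at most as far apart. The sum of two values of a univariate
  discrete convex function does not increase when the two arguments are brought closer together with
  their sum kept fixed (\<open>discrete_convex_contract\<close>). Hence each summand of a 2-separable convex function satisfies the
  directed midpoint inequality, and adding these inequalities gives it for the function itself.

  Infinite values interfere only in the univariate step. There, if both outer values are finite,
  the effective domain being an interval makes every value in between finite as well, and the
  argument takes place in the reals.
\<close>

text \<open>
  The increments of a convex sequence are nondecreasing; comparing the first and the last one says
  that moving two arguments one step apart does not decrease the sum of the values.
\<close>

lemma convex_sequence_spread_step:
  fixes h :: "int \<Rightarrow> real"
  assumes convex: "\<And>t. a < t \<Longrightarrow> t < b \<Longrightarrow> 2 * h t \<le> h (t - 1) + h (t + 1)"
    and "a < p" "p \<le> q" "q < b"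
  shows "h p + h q \<le> h (p - 1) + h (q + 1)"
  using \<open>p \<le> q\<close> \<open>q < b\<close>
proof (induction q rule: int_ge_induct)
  case base
  then show ?case using convex[of p] \<open>a < p\<close> by simp
next
  case (step q)
  then show ?case using convex[of "q + 1"] \<open>a < p\<close> by simp
qed

lemma convex_sequence_spread:
  fixes h :: "int \<Rightarrow> real"
  assumes convex: "\<And>t. a < t \<Longrightarrow> t < b \<Longrightarrow> 2 * h t \<le> h (t - 1) + h (t + 1)"
    and "p \<le> q" "a \<le> p - int k" "q + int k \<le> b"
  shows "h p + h q \<le> h (p - int k) + h (q + int k)"
  using assms(3,4)
proof (induction k)
  case 0
  then show ?case by simp
next
  case (Suc k)
  have "h (p - int k) + h (q + int k) \<le> h (p - int k - 1) + h (q + int k + 1)"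
    using Suc.prems \<open>p \<le> q\<close> by (intro convex_sequence_spread_step[of a b] convex) auto
  with Suc show ?case by (simp add: algebra_simps)
qed

lemma discrete_convex_contract_ordered:
  assumes g: "discrete_convex g" and "a \<le> p" "p \<le> q" "p + q = a + b"
  shows "g p + g q \<le> g a + g b"
proof (cases "g a < \<infinity> \<and> g b < \<infinity>")
  case False
  then have "g a + g b = \<infinity>" by auto
  then show ?thesis by (metis ereal_less_eq(1))
next
  case True
  define h where "h t = real_of_ereal (g t)" for t
  have g_eq: "g t = ereal (h t)" if "a \<le> t" "t \<le> b" for t
  proof -
    have "g t < \<infinity>" "g t \<noteq> -\<infinity>"
      using g True that unfolding discrete_convex_def by blast+
    then show ?thesis by (cases "g t") (simp_all add: h_def)
  qed
  have h_convex: "2 * h t \<le> h (t - 1) + h (t + 1)" if "a < t" "t < b" for t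
  proof -
    have "2 * g t \<le> g (t - 1) + g (t + 1)"
      using g unfolding discrete_convex_def by blast
    then show ?thesis using that by (simp add: g_eq)
  qed
  \<comment> \<open>As \<open>p - a = b - q\<close>, both arguments reach the ends of the interval after \<open>p - a\<close> steps.\<close>
  have "h p + h q \<le> h (p - int (nat (p - a))) + h (q + int (nat (p - a)))"
    using assms by (intro convex_sequence_spread[of a b] h_convex) auto
  also have "\<dots> = h a + h b"
    using assms by (simp add: algebra_simps)
  finally show ?thesis using assms by (simp add: g_eq)
qed

text \<open>
  The hypothesis bounds the distance of the inner pair so that neither pair has to be given in
  increasing order, which depends on the signs of the components of \<open>x - y\<close>.
\<close>

lemma discrete_convex_contract:
  assumes g: "discrete_convex g" and sum: "p + q = a + b" and dist: "\<bar>p - q\<bar> \<le> \<bar>a - b\<bar>"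
  shows "g p + g q \<le> g a + g b"
proof -
  have "g (min p q) + g (max p q) \<le> g (min a b) + g (max a b)"
    using sum dist by (intro discrete_convex_contract_ordered[OF g]) auto
  then show ?thesis by (simp add: min_def max_def add.commute split: if_splits)
qed

lemma ceiling_half_eq_floor_half:
  "\<lceil>real_of_int m / 2\<rceil> = \<lfloor>real_of_int m / 2\<rfloor> + m mod 2"
proof -
  have "\<lceil>real_of_int m / 2\<rceil> = - (- m div 2)" "\<lfloor>real_of_int m / 2\<rfloor> = m div 2"
    using ceiling_divide_eq_div[of m 2, where ?'a = real]
      floor_divide_of_int_eq[of m 2, where ?'a = real] by simp_all
  moreover have "- (- m div 2) = m div 2 + m mod 2" by presburger
  ultimately show ?thesis by simp
qed

lemma directed_midpoint_sum:
  "directed_midpoint x y $ i + directed_midpoint y x $ i = x $ i + y $ i"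
proof -
  have "\<lfloor>real_of_int m / 2\<rfloor> + \<lfloor>real_of_int m / 2\<rfloor> + m mod 2 = m" for m
    using floor_divide_of_int_eq[of m 2, where ?'a = real] by simp
  from this[of "x $ i + y $ i"] show ?thesis
    unfolding directed_midpoint_def
    by (cases "x $ i" "y $ i" rule: linorder_cases)
      (simp_all add: ceiling_half_eq_floor_half add.commute del: of_int_add)
qed

lemma directed_midpoint_diff:
  "directed_midpoint x y $ i - directed_midpoint y x $ i
     = sgn (x $ i - y $ i) * ((x $ i - y $ i) mod 2)"
proof -
  have "(x $ i + y $ i) mod 2 = (x $ i - y $ i) mod 2" by presburger
  then show ?thesis
    unfolding directed_midpoint_def
    by (cases "x $ i" "y $ i" rule: linorder_cases)
      (simp_all add: ceiling_half_eq_floor_half add.commute del: of_int_add)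
qed

text \<open>
  If exactly one of \<open>c\<close> and \<open>d\<close> is odd, the left side is \<open>1\<close> and \<open>c + d\<close>, being odd, is nonzero. If both
  are odd, the left side is \<open>0\<close> unless they have the same sign, and then \<open>\<bar>c + d\<bar> \<ge> 2\<close>.
\<close>

lemma abs_signed_parity_add_le:
  fixes c d :: int
  shows "\<bar>sgn c * (c mod 2) + sgn d * (d mod 2)\<bar> \<le> \<bar>c + d\<bar>"
proof -
  have "\<bar>sgn c * m + sgn d * n\<bar> \<le> \<bar>c + d\<bar>"
    if "m = 0 \<or> m = 1" "n = 0 \<or> n = 1" "m \<noteq> n \<Longrightarrow> 1 \<le> \<bar>c + d\<bar>" for m n
    using that by (elim disjE) (simp_all add: sgn_if)
  moreover have "k mod 2 = 0 \<or> k mod 2 = 1" for k :: int by presburger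
  moreover have "c mod 2 \<noteq> d mod 2 \<Longrightarrow> 1 \<le> \<bar>c + d\<bar>" by presburger
  ultimately show ?thesis by blast
qed

lemma abs_signed_parity_diff_le:
  fixes c d :: int
  shows "\<bar>sgn c * (c mod 2) - sgn d * (d mod 2)\<bar> \<le> \<bar>c - d\<bar>"
proof -
  have "(- d) mod 2 = d mod 2" by presburger
  then show ?thesis using abs_signed_parity_add_le[of c "- d"] by (simp add: sgn_minus)
qed

theorem theorem3p8:
  fixes f :: "int ^ 'n \<Rightarrow> ereal"
  assumes "two_separable_convex f"
  shows "ddm_convex f"
  unfolding ddm_convex_def
proof (intro conjI allI)
  show "f x \<noteq> -\<infinity>" for x
    using assms unfolding two_separable_convex_def by blast
next
  fix x y :: "int ^ 'n"
  obtain \<xi> \<phi> \<psi> where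
    \<xi>: "\<And>i. discrete_convex (\<xi> i)" and
    \<phi>: "\<And>i j. j \<noteq> i \<Longrightarrow> discrete_convex (\<phi> i j)" and
    \<psi>: "\<And>i j. j \<noteq> i \<Longrightarrow> discrete_convex (\<psi> i j)" and
    f: "\<And>x. f x = (\<Sum>i\<in>UNIV. \<xi> i (x $ i))
                 + (\<Sum>i\<in>UNIV. \<Sum>j\<in>UNIV - {i}. \<phi> i j (x $ i - x $ j))
                 + (\<Sum>i\<in>UNIV. \<Sum>j\<in>UNIV - {i}. \<psi> i j (x $ i + x $ j))"
    using assms unfolding two_separable_convex_def
    by (elim conjE exE) (rule that, simp_all)
  have f_add: "f u + f v = (\<Sum>i\<in>UNIV. \<xi> i (u $ i) + \<xi> i (v $ i))
      + (\<Sum>i\<in>UNIV. \<Sum>j\<in>UNIV - {i}. \<phi> i j (u $ i - u $ j) + \<phi> i j (v $ i - v $ j))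
      + (\<Sum>i\<in>UNIV. \<Sum>j\<in>UNIV - {i}. \<psi> i j (u $ i + u $ j) + \<psi> i j (v $ i + v $ j))" for u v
    unfolding f by (simp add: sum.distrib ac_simps)
  define p q where "p = directed_midpoint x y" and "q = directed_midpoint y x"
  have sum: "p $ i + q $ i = x $ i + y $ i" for i
    unfolding p_def q_def by (rule directed_midpoint_sum)
  have diff: "p $ i - q $ i = sgn (x $ i - y $ i) * ((x $ i - y $ i) mod 2)" for i
    unfolding p_def q_def by (rule directed_midpoint_diff)
  have unary: "\<bar>p $ i - q $ i\<bar> \<le> \<bar>x $ i - y $ i\<bar>" for i
    using abs_signed_parity_add_le[of "x $ i - y $ i" 0] by (simp add: diff)
  have minus: "\<bar>(p $ i - p $ j) - (q $ i - q $ j)\<bar> \<le> \<bar>(x $ i - x $ j) - (y $ i - y $ j)\<bar>" for i j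
    using abs_signed_parity_diff_le[of "x $ i - y $ i" "x $ j - y $ j"]
    unfolding diff[symmetric] by (simp add: algebra_simps)
  have plus: "\<bar>(p $ i + p $ j) - (q $ i + q $ j)\<bar> \<le> \<bar>(x $ i + x $ j) - (y $ i + y $ j)\<bar>" for i j
    using abs_signed_parity_add_le[of "x $ i - y $ i" "x $ j - y $ j"]
    unfolding diff[symmetric] by (simp add: algebra_simps)
  have "f p + f q \<le> f x + f y"
    unfolding f_add
  proof (rule add_mono[OF add_mono]; intro sum_mono)
    fix i
    show "\<xi> i (p $ i) + \<xi> i (q $ i) \<le> \<xi> i (x $ i) + \<xi> i (y $ i)"
      using \<xi> sum unary by (rule discrete_convex_contract)
  next
    fix i j :: 'n
    assume "j \<in> UNIV - {i}"
    then have "j \<noteq> i" by simp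
    show "\<phi> i j (p $ i - p $ j) + \<phi> i j (q $ i - q $ j)
        \<le> \<phi> i j (x $ i - x $ j) + \<phi> i j (y $ i - y $ j)"
      using sum[of i] sum[of j] by (intro discrete_convex_contract \<phi> \<open>j \<noteq> i\<close> minus) simp
    show "\<psi> i j (p $ i + p $ j) + \<psi> i j (q $ i + q $ j)
        \<le> \<psi> i j (x $ i + x $ j) + \<psi> i j (y $ i + y $ j)"
      using sum[of i] sum[of j] by (intro discrete_convex_contract \<psi> \<open>j \<noteq> i\<close> plus) simp
  qed
  then show "f (directed_midpoint x y) + f (directed_midpoint y x) \<le> f x + f y"
    by (simp add: p_def q_def)
qed

end
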